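(* Let $n\ge 1$ and let $A\in \mathbb{M}_n(\mathbb{C})$ be magic squared, i.e. every entry of $A$ is a non-negative real number and there is a number $\alpha$ such that $A\xi_0=\alpha\xi_0={}^tA\,\xi_0$, where $\xi_0={}^t(1,1,\ldots,1)\in\mathbb{C}^n$. Then for all $p,q$ with $1\le q\le p\le\infty$, $$\|A\|_{p,q}=\max\{\|A\xi\|_q : \xi\in\ell^p(n),\ \|\xi\|_p=1\}=\alpha\, n^{\frac1q-\frac1p}.$$
   Context: $\mathbb{M}_n(\mathbb{C})$ is the set of $n\times n$ complex matrices and ${}^tA$ is the transpose of $A$. $\ell^p(n)$ is $\mathbb{C}^n$ with the norm $\|\xi\|_p=(\sum_{i=1}^n|x_i|^p)^{1/p}$ for $1\le p<\infty$ and $\|\xi\|_\infty=\max_i|x_i|$, where $\xi={}^t(x_1,\ldots,x_n)$. For $p,q\in[1,\infty]$, $\|A\|_{p,q}=\max\{\|A\xi\|_q:\xi\in\ell^p(n),\ \|\xi\|_p=1\}$ is the operator norm of $A:\ell^p(n)\to\ell^q(n)$. Convention: $1/\infty=0$. *)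

theory Defs
  imports "HOL-Analysis.Analysis"
begin

text \<open>Exponents are extended reals; only values in \<open>[1, \<infinity>]\<close> are meaningful. The library's
  \<open>infnorm\<close> is not used for exponent \<open>\<infinity>\<close>: on complex vectors it takes the maximum over real
  and imaginary parts rather than over moduli.\<close>

definition lp_norm :: "ereal \<Rightarrow> complex^'n \<Rightarrow> real" where
  "lp_norm p \<xi> =
     (if p = \<infinity> then Max (range (\<lambda>i. cmod (\<xi> $ i)))
      else (\<Sum>i\<in>UNIV. cmod (\<xi> $ i) powr real_of_ereal p) powr (1 / real_of_ereal p))"

definition lp_sphere_image :: "ereal \<Rightarrow> ereal \<Rightarrow> complex^'n^'n \<Rightarrow> real set" where
  "lp_sphere_image p q A = {lp_norm q (A *v \<xi>) | \<xi>. lp_norm p \<xi> = 1}"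

text \<open>\<open>GREATEST\<close> renders the maximum of a possibly infinite set; it is unspecified if the
  maximum is not attained.\<close>

definition lp_opnorm :: "ereal \<Rightarrow> ereal \<Rightarrow> complex^'n^'n \<Rightarrow> real" where
  "lp_opnorm p q A = (GREATEST y. y \<in> lp_sphere_image p q A)"

text \<open>A matrix is magic squared if \<open>magic_squared A \<alpha>\<close> holds for some \<open>\<alpha>\<close>. The vector
  \<open>1 :: complex^'n\<close> has all its entries equal to 1.\<close>

definition magic_squared :: "complex^'n^'n \<Rightarrow> complex \<Rightarrow> bool" where
  "magic_squared A \<alpha> \<longleftrightarrow>
     (\<forall>i j. A $ i $ j \<in> \<real>\<^sub>\<ge>\<^sub>0) \<and>
     A *v 1 = \<alpha> *s 1 \<and> transpose A *v 1 = \<alpha> *s 1"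

end

theory Submission
  imports Defs
begin

text \<open>Jensen's inequality for the convex function \<open>t \<mapsto> t powr r\<close>, applied with each row of \<open>A\<close> as weights
  and summed over the rows, bounds \<open>A\<close> on each \<open>\<ell>\<^sup>q\<close> by \<open>\<alpha>\<close>: the row sums normalise the weights,
  the column sums evaluate the total. Jensen with constant weights bounds the inclusion of \<open>\<ell>\<^sup>p\<close>
  in \<open>\<ell>\<^sup>q\<close> by \<open>n powr (1 / q - 1 / p)\<close>. Both bounds are attained at constant vectors.\<close>

text \<open>Entries of a vector may vanish, so the endpoint 0 must belong to the domain. Between
  positive points this is \<open>powr_convex\<close>; if one point is 0, it reduces to
  \<open>t powr r \<le> t\<close> for \<open>0 < t < 1\<close>.\<close>

lemma convex_on_powr_atLeast:
  fixes r :: real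
  assumes "1 \<le> r"
  shows "convex_on {0..} (\<lambda>t. t powr r)"
proof (rule convex_onI)
  have scale: "(t * x) powr r \<le> t * x powr r" if "0 < t" "t < 1" "0 \<le> x" for t x :: real
    using that assms powr_mono'[of 1 r t] by (simp add: powr_mult mult_right_mono)
  fix t x y :: real
  assume t: "0 < t" "t < 1" and xy: "x \<in> {0..}" "y \<in> {0..}"
  consider "x = 0" | "y = 0" | "0 < x" "0 < y" using xy by fastforce
  then show "((1 - t) *\<^sub>R x + t *\<^sub>R y) powr r \<le> (1 - t) * x powr r + t * y powr r"
  proof cases
    case 3
    then show ?thesis using convex_onD[OF powr_convex[OF assms], of t x y] t by simp
  qed (use t xy scale[of t y] scale[of "1 - t" x] in auto)
qed simp

text \<open>Jensen's inequality for the weights \<open>w i / W\<close> with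
  \<open>W = sum w I\<close>; undoing the normalisation costs \<open>W powr r / W\<close>. If the
  total is 0, all weights vanish and both sides are 0.\<close>

lemma powr_sum_weighted_le:
  fixes w x :: "'a \<Rightarrow> real"
  assumes "finite I" and r: "1 \<le> r"
    and w: "\<And>i. i \<in> I \<Longrightarrow> 0 \<le> w i" and x: "\<And>i. i \<in> I \<Longrightarrow> 0 \<le> x i"
  shows "(\<Sum>i\<in>I. w i * x i) powr r \<le> sum w I powr (r - 1) * (\<Sum>i\<in>I. w i * x i powr r)"
proof (cases "sum w I = 0")
  case True
  then have "\<forall>i\<in>I. w i = 0"
    using assms(1) w by (subst (asm) sum_nonneg_eq_0_iff) auto
  then show ?thesis by simp
next
  case False
  define W where "W = sum w I"
  have W: "0 < W" using False w unfolding W_def by (metis order_le_less sum_nonneg)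
  have "I \<noteq> {}" using False by auto
  have conv: "convex_on {0..} (\<lambda>t::real. t powr r)"
    using r by (rule convex_on_powr_atLeast)
  have "(\<Sum>i\<in>I. (w i / W) *\<^sub>R x i) powr r \<le> (\<Sum>i\<in>I. (w i / W) * x i powr r)"
    using W w x \<open>I \<noteq> {}\<close> assms(1)
    by (intro convex_on_sum[OF _ _ conv]) (auto simp: W_def simp flip: sum_divide_distrib)
  then have J: "((\<Sum>i\<in>I. w i * x i) / W) powr r \<le> (\<Sum>i\<in>I. w i * x i powr r) / W"
    by (simp add: sum_divide_distrib)
  have "0 \<le> (\<Sum>i\<in>I. w i * x i)" by (intro sum_nonneg mult_nonneg_nonneg w x)
  then have "(\<Sum>i\<in>I. w i * x i) powr r = W powr r * ((\<Sum>i\<in>I. w i * x i) / W) powr r"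
    using W by (simp flip: powr_mult)
  also have "\<dots> \<le> W powr r * ((\<Sum>i\<in>I. w i * x i powr r) / W)"
    using J by (rule mult_left_mono) simp
  also have "\<dots> = W powr (r - 1) * (\<Sum>i\<in>I. w i * x i powr r)"
    using W by (simp add: powr_diff)
  finally show ?thesis by (simp add: W_def)
qed

lemma ereal_ge_1_cases:
  assumes "(1::ereal) \<le> p"
  obtains "p = \<infinity>" | r where "p = ereal r" "1 \<le> r"
  using assms by (cases p) auto

lemma lp_norm_ereal:
  "lp_norm (ereal r) \<xi> = (\<Sum>i\<in>UNIV. cmod (\<xi> $ i) powr r) powr (1 / r)"
  by (simp add: lp_norm_def)

lemma lp_norm_infinity: "lp_norm \<infinity> \<xi> = Max (range (\<lambda>i. cmod (\<xi> $ i)))"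
  by (simp add: lp_norm_def)

lemma cmod_le_lp_norm_infinity: "cmod (\<xi> $ i) \<le> lp_norm \<infinity> \<xi>"
  by (simp add: lp_norm_infinity)

lemma lp_norm_infinity_le_iff: "lp_norm \<infinity> \<xi> \<le> c \<longleftrightarrow> (\<forall>i. cmod (\<xi> $ i) \<le> c)"
  by (simp add: lp_norm_infinity)

lemma lp_norm_ereal_powr:
  assumes "1 \<le> r"
  shows "lp_norm (ereal r) \<xi> powr r = (\<Sum>i\<in>UNIV. cmod (\<xi> $ i) powr r)"
  using assms by (simp add: lp_norm_ereal powr_powr sum_nonneg)

lemma lp_norm_ereal_nonneg: "0 \<le> lp_norm (ereal r) \<xi>"
  by (simp add: lp_norm_ereal)

lemma lp_norm_ereal_leI:
  assumes "1 \<le> r" "0 \<le> c" "(\<Sum>i\<in>UNIV. cmod (\<xi> $ i) powr r) \<le> c powr r"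
  shows "lp_norm (ereal r) \<xi> \<le> c"
proof -
  have "lp_norm (ereal r) \<xi> powr r \<le> c powr r"
    using assms by (simp add: lp_norm_ereal_powr)
  then show ?thesis
    using assms by (metis lp_norm_ereal_nonneg not_le powr_less_mono2 zero_less_one order_less_le_trans)
qed

text \<open>Since \<open>1 / \<infinity> = 0\<close>, the factor is 1 for the maximum norm, so one
  formula evaluates constant vectors for every exponent.\<close>

lemma lp_norm_vec:
  assumes "1 \<le> p"
  shows "lp_norm p (vec c :: complex^'n) = real CARD('n) powr real_of_ereal (1 / p) * cmod c"
  using assms
proof (cases rule: ereal_ge_1_cases)
  case 1
  then show ?thesis by (simp add: lp_norm_infinity)
next
  case (2 r)
  then show ?thesis
    by (simp add: lp_norm_ereal powr_mult powr_powr one_ereal_def)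
qed

text \<open>For finite exponents \<open>s \<le> r\<close>, this is Jensen with unit weights and
  exponent \<open>r / s\<close>, applied to the numbers \<open>cmod (\<xi> $ i) powr s\<close>. For
  \<open>p = \<infinity>\<close>, each entry is bounded by the maximum.\<close>

lemma lp_norm_le_card_powr:
  fixes \<xi> :: "complex^'n"
  assumes "1 \<le> q" "q \<le> p"
  shows "lp_norm q \<xi> \<le> real CARD('n) powr real_of_ereal (1 / q - 1 / p) * lp_norm p \<xi>"
proof -
  let ?n = "real CARD('n)"
  have "1 \<le> p" using assms by order
  from assms(1) show ?thesis
  proof (cases rule: ereal_ge_1_cases)
    case 1
    \<comment> \<open>Here \<open>q \<le> p\<close> forces \<open>p = \<infinity>\<close>, and the
      exponent of \<open>n\<close> is 0.\<close>
    then show ?thesis using assms by (simp add: zero_ereal_def)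
  next
    case (2 s)
    show ?thesis using \<open>1 \<le> p\<close>
    proof (cases rule: ereal_ge_1_cases)
      case 1
      let ?m = "lp_norm \<infinity> \<xi>"
      have m: "0 \<le> ?m" using cmod_le_lp_norm_infinity norm_ge_zero order_trans by blast
      have "(\<Sum>i\<in>UNIV. cmod (\<xi> $ i) powr s) \<le> (\<Sum>i\<in>(UNIV::'n set). ?m powr s)"
        using 2 by (intro sum_mono powr_mono2 cmod_le_lp_norm_infinity) auto
      also have "\<dots> = (?n powr (1 / s) * ?m) powr s"
        using 2 m by (simp add: powr_mult powr_powr)
      finally have "lp_norm q \<xi> \<le> ?n powr (1 / s) * ?m"
        using 2 m by (simp add: lp_norm_ereal_leI)
      then show ?thesis using 1 2 by (simp add: one_ereal_def)
    next
      case (2 r)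
      have sr: "s \<le> r" "1 \<le> r / s" using \<open>q = ereal s\<close> \<open>1 \<le> s\<close> 2 assms by auto
      let ?S = "\<lambda>t. \<Sum>i\<in>UNIV. cmod (\<xi> $ i) powr t"
      have "?S s powr (r / s) \<le> ?n powr (r / s - 1) * ?S r"
        using powr_sum_weighted_le[of UNIV "r / s" "\<lambda>_. 1" "\<lambda>i. cmod (\<xi> $ i) powr s"] sr \<open>1 \<le> s\<close>
        by (simp add: powr_powr)
      \<comment> \<open>The \<open>r\<close>-th root turns the exponent \<open>r / s - 1\<close> of
        \<open>n\<close> into \<open>1 / s - 1 / r\<close>.\<close>
      then have "(?S s powr (r / s)) powr (1 / r) \<le> (?n powr (r / s - 1) * ?S r) powr (1 / r)"
        using \<open>1 \<le> r\<close> by (intro powr_mono2) auto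
      also have "\<dots> = ?n powr (1 / s - 1 / r) * lp_norm p \<xi>"
        using 2 \<open>1 \<le> s\<close>
        by (simp add: lp_norm_ereal powr_mult powr_powr sum_nonneg diff_divide_distrib)
      also have "(?S s powr (r / s)) powr (1 / r) = lp_norm q \<xi>"
        using \<open>q = ereal s\<close> \<open>1 \<le> r\<close> by (simp add: lp_norm_ereal powr_powr)
      finally show ?thesis using 2 \<open>q = ereal s\<close> \<open>1 \<le> s\<close> by (simp add: one_ereal_def)
    qed
  qed
qed

text \<open>Evaluating \<open>A\<close> and its transpose at the all-ones vector gives the row and
  column sums, so \<alpha> is itself a sum of non-negative reals.\<close>

lemma magic_squaredE:
  fixes A :: "complex^'n^'n"
  assumes "magic_squared A \<alpha>"
  obtains a B where "0 \<le> a" "\<alpha> = complex_of_real a"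
    "\<And>i j. A $ i $ j = complex_of_real (B i j)" "\<And>i j. 0 \<le> B i j"
    "\<And>i. (\<Sum>j\<in>UNIV. B i j) = a" "\<And>j. (\<Sum>i\<in>UNIV. B i j) = a"
proof -
  define B where "B i j = Re (A $ i $ j)" for i j
  have A: "A $ i $ j = complex_of_real (B i j)" and B: "0 \<le> B i j" for i j
    using assms by (auto simp: magic_squared_def B_def complex_nonneg_Reals_iff complex_eq_iff)
  have row: "complex_of_real (\<Sum>j\<in>UNIV. B i j) = \<alpha>" for i
    using assms by (simp add: magic_squared_def vec_eq_iff matrix_vector_mult_def A)
  have col: "complex_of_real (\<Sum>i\<in>UNIV. B i j) = \<alpha>" for j
    using assms by (simp add: magic_squared_def vec_eq_iff matrix_vector_mult_def transpose_def A)
  \<comment> \<open>All rows have the same sum, so \<open>undefined\<close> serves as an arbitrary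
    row index.\<close>
  let ?a = "\<Sum>j\<in>UNIV. B undefined j"
  show thesis
  proof
    show "0 \<le> ?a" by (intro sum_nonneg B)
    show "\<alpha> = complex_of_real ?a" by (simp only: row)
    show "(\<Sum>j\<in>UNIV. B i j) = ?a" for i by (metis row of_real_eq_iff)
    show "(\<Sum>i\<in>UNIV. B i j) = ?a" for j by (metis row col of_real_eq_iff)
  qed (fact A B)+
qed

text \<open>For \<open>q = \<infinity>\<close> the row sums suffice. For finite
  \<open>q = r\<close>, Jensen in each row contributes \<open>a powr (r - 1)\<close>, and the column
  sums contribute the remaining factor \<open>a\<close>.\<close>

lemma lp_norm_magic_squared_le:
  fixes A :: "complex^'n^'n"
  assumes "magic_squared A \<alpha>" and "1 \<le> q"
  shows "lp_norm q (A *v \<xi>) \<le> cmod \<alpha> * lp_norm q \<xi>"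
proof -
  obtain a B where a: "0 \<le> a" "\<alpha> = complex_of_real a"
    and A: "\<And>i j. A $ i $ j = complex_of_real (B i j)" and B: "\<And>i j. 0 \<le> B i j"
    and row: "\<And>i. (\<Sum>j\<in>UNIV. B i j) = a" and col: "\<And>j. (\<Sum>i\<in>UNIV. B i j) = a"
    using assms(1) by (rule magic_squaredE) (rule that)
  have entry: "cmod ((A *v \<xi>) $ i) \<le> (\<Sum>j\<in>UNIV. B i j * cmod (\<xi> $ j))" for i
    unfolding matrix_vector_mult_def
    by (simp add: A) (rule norm_sum[THEN order_trans], simp add: norm_mult B)
  from assms(2) show ?thesis
  proof (cases rule: ereal_ge_1_cases)
    case 1
    have "cmod ((A *v \<xi>) $ i) \<le> (\<Sum>j\<in>UNIV. B i j * lp_norm \<infinity> \<xi>)" for i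
      using entry
      by (rule order_trans) (intro sum_mono mult_left_mono cmod_le_lp_norm_infinity B)
    then show ?thesis
      using 1 a by (simp add: lp_norm_infinity_le_iff row flip: sum_distrib_right)
  next
    case (2 r)
    have "(\<Sum>i\<in>UNIV. cmod ((A *v \<xi>) $ i) powr r)
        \<le> (\<Sum>i\<in>UNIV. (\<Sum>j\<in>UNIV. B i j * cmod (\<xi> $ j)) powr r)"
      using 2 by (intro sum_mono powr_mono2 entry) auto
    also have "\<dots> \<le> (\<Sum>i\<in>UNIV. a powr (r - 1) * (\<Sum>j\<in>UNIV. B i j * cmod (\<xi> $ j) powr r))"
    proof (rule sum_mono)
      show "(\<Sum>j\<in>UNIV. B i j * cmod (\<xi> $ j)) powr r
          \<le> a powr (r - 1) * (\<Sum>j\<in>UNIV. B i j * cmod (\<xi> $ j) powr r)" for i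
        using powr_sum_weighted_le[of UNIV r "B i" "\<lambda>j. cmod (\<xi> $ j)"] 2 B by (simp add: row)
    qed
    \<comment> \<open>With \<open>j\<close> outermost, the inner sum runs down a column of
      \<open>B\<close> against a fixed entry of \<xi>.\<close>
    also have "\<dots> = a powr (r - 1) * (\<Sum>j\<in>UNIV. \<Sum>i\<in>UNIV. B i j * cmod (\<xi> $ j) powr r)"
      by (subst sum.swap) (simp add: sum_distrib_left)
    also have "\<dots> = a powr (r - 1) * a * (\<Sum>j\<in>UNIV. cmod (\<xi> $ j) powr r)"
      by (simp add: col sum_distrib_left mult.assoc flip: sum_distrib_right)
    also have "a powr (r - 1) * a = a powr r"
      using a by (simp add: powr_diff)
    also have "a powr r * (\<Sum>j\<in>UNIV. cmod (\<xi> $ j) powr r) = (a * lp_norm q \<xi>) powr r"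
      using 2 a by (simp add: powr_mult lp_norm_ereal_nonneg lp_norm_ereal_powr)
    finally show ?thesis
      using 2 a by (simp add: lp_norm_ereal_leI lp_norm_ereal_nonneg)
  qed
qed

theorem theorem1p1:
  fixes A :: "complex^'n^'n" and \<alpha> :: complex and p q :: ereal
  assumes "magic_squared A \<alpha>"
    and "1 \<le> q" and "q \<le> p"
  shows "lp_opnorm p q A \<in> lp_sphere_image p q A \<and>
         (\<forall>y\<in>lp_sphere_image p q A. y \<le> lp_opnorm p q A) \<and>
         complex_of_real (lp_opnorm p q A) =
           \<alpha> * complex_of_real (real CARD('n) powr real_of_ereal (1 / q - 1 / p))"
proof -
  let ?n = "real CARD('n)"
  let ?P = "real_of_ereal (1 / p)" and ?Q = "real_of_ereal (1 / q)"
  define M where "M = cmod \<alpha> * ?n powr real_of_ereal (1 / q - 1 / p)"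
  have p: "1 \<le> p" using assms by order
  \<comment> \<open>Both reciprocals are finite because the exponents are at least 1, so the
    difference can be taken in the reals.\<close>
  have exponent: "real_of_ereal (1 / q - 1 / p) = ?Q - ?P"
    using assms(2) p by (elim ereal_ge_1_cases) (auto simp: one_ereal_def zero_ereal_def)
  \<comment> \<open>The constant vector normalised in the \<open>p\<close>-norm: the norm of the
    all-ones vector is \<open>?n powr ?P\<close>.\<close>
  define \<eta> where "\<eta> = (vec (complex_of_real (?n powr - ?P)) :: complex^'n)"
  have "lp_norm p \<eta> = 1"
    using p by (simp add: \<eta>_def lp_norm_vec flip: powr_add)
  have "\<eta> = complex_of_real (?n powr - ?P) *s 1"
    by (simp add: \<eta>_def vec_eq_iff)
  then have "A *v \<eta> = complex_of_real (?n powr - ?P) *s (A *v 1)"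
    by (simp add: vector_scalar_commute)
  also have "\<dots> = vec (complex_of_real (?n powr - ?P) * \<alpha>)"
    using assms(1) by (simp add: magic_squared_def vec_eq_iff)
  finally have "lp_norm q (A *v \<eta>) = M"
    using assms(2)
    by (simp add: lp_norm_vec M_def exponent norm_mult norm_divide powr_diff powr_minus field_simps)
  with \<open>lp_norm p \<eta> = 1\<close> have mem: "M \<in> lp_sphere_image p q A"
    unfolding lp_sphere_image_def by blast
  have upper: "y \<le> M" if y: "y \<in> lp_sphere_image p q A" for y
  proof -
    obtain \<xi> where \<xi>: "y = lp_norm q (A *v \<xi>)" "lp_norm p \<xi> = 1"
      using y unfolding lp_sphere_image_def by blast
    \<comment> \<open>\<open>A\<close> is bounded on the \<open>q\<close>-norm first; the passage
      from the \<open>q\<close>-norm to the \<open>p\<close>-norm of \<xi> then supplies the power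
      of \<open>n\<close>.\<close>
    have "y \<le> cmod \<alpha> * lp_norm q \<xi>"
      using lp_norm_magic_squared_le assms(1,2) \<xi> by blast
    also have "\<dots> \<le> M"
      unfolding M_def using lp_norm_le_card_powr[OF assms(2,3), of \<xi>] \<xi>
      by (intro mult_left_mono) auto
    finally show ?thesis .
  qed
  \<comment> \<open>An upper bound that belongs to the set is its \<open>GREATEST\<close> element,
    so the maximum is attained.\<close>
  have "lp_opnorm p q A = M"
    unfolding lp_opnorm_def using mem upper by (rule Greatest_equality)
  moreover have "\<alpha> = complex_of_real (cmod \<alpha>)"
    using assms(1) by (rule magic_squaredE) simp
  ultimately show ?thesis
    using mem upper by (metis M_def of_real_mult)
qed

end
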